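(* It is not true that the inequality $$\mathcal{T}\bigl(\mu^{(m+1)},\nu^{(m+1)}\bigr)\le\mathcal{T}\bigl(\mu^{(m)},\nu^{(m)}\bigr)$$ holds for all Borel probability measures $\mu,\nu$ on $\mathbb{R}^d$ with finite second moments and vanishing barycenter and all $m\in\mathbb{N}$, $m\ge1$, even for $d=1$ and symmetric measures. Specifically, let $(Z_i)_{i\in\mathbb{N}}$ be i.i.d. random variables with $\mathbb{P}(Z_1=1)=\mathbb{P}(Z_1=-1)=\frac12$, let $\mu_n$ be the distribution of $\sum_{i=1}^{2n-1}Z_i$, and let $\nu_n$ be the distribution of $\sum_{i=1}^{2n}Z_i$. Then for all sufficiently large $n$ the inequality fails for $\mu=\mu_n$, $\nu=\nu_n$ and $m=2$, that is, $$\mathcal{T}\bigl(\mu_n^{(3)},\nu_n^{(3)}\bigr)>\mathcal{T}\bigl(\mu_n^{(2)},\nu_n^{(2)}\bigr).$$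
   Context: For Borel probability measures $\mu,\nu$ on $\mathbb{R}^d$, the quadratic Wasserstein distance is defined (without taking a square root) by $$\mathcal{T}(\mu,\nu):=\inf_{(X,Y)}\mathbb{E}\bigl[\|X-Y\|^2\bigr],$$ where $\|\cdot\|$ is the Euclidean norm and the infimum runs over all pairs of random vectors $(X,Y)$ defined on some common probability space such that $X$ has distribution $\mu$ and $Y$ has distribution $\nu$. For a probability measure $\mu$ on $\mathbb{R}^d$ and $m\ge1$, $\mu^{(m)}$ denotes the law of the normalized partial sum $S_m=\frac{1}{\sqrt m}\sum_{i=1}^m X_i$, where $(X_i)_{i\in\mathbb{N}}$ are i.i.d. random vectors with law $\mu$. A measure on $\mathbb{R}$ is symmetric if it is invariant under $x\mapsto -x$. Vanishing barycenter means that the mean is zero. *)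

theory Defs
  imports "HOL-Probability.Probability"
begin

definition borel_prob :: "'a::euclidean_space measure \<Rightarrow> bool" where
  "borel_prob \<mu> \<longleftrightarrow> prob_space \<mu> \<and> sets \<mu> = sets borel"

definition finite_second_moment :: "'a::euclidean_space measure \<Rightarrow> bool" where
  "finite_second_moment \<mu> \<longleftrightarrow> integrable \<mu> (\<lambda>x. (norm x)\<^sup>2)"

definition vanishing_barycenter :: "'a::euclidean_space measure \<Rightarrow> bool" where
  "vanishing_barycenter \<mu> \<longleftrightarrow> integrable \<mu> (\<lambda>x. x) \<and> (\<integral>x. x \<partial>\<mu>) = 0"

definition symmetric_measure :: "real measure \<Rightarrow> bool" where
  "symmetric_measure \<mu> \<longleftrightarrow> distr \<mu> borel uminus = \<mu>"

text \<open>
  A definition cannot range over probability spaces of all types, so the pairs \<open>(X, Y)\<close> live on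
  probability spaces with points in \<^typ>\<open>'a \<times> 'a\<close>. Lemma \<open>wasserstein_le\<close> below shows that
  pairs on any other probability space do not lower the infimum. The value is in
  \<^typ>\<open>ennreal\<close>, so an infinite expectation counts as infinite rather than as 0.
\<close>

definition wasserstein :: "'a::euclidean_space measure \<Rightarrow> 'a measure \<Rightarrow> ennreal" where
  "wasserstein \<mu> \<nu> = Inf {\<integral>\<^sup>+ \<omega>. ennreal ((norm (X \<omega> - Y \<omega>))\<^sup>2) \<partial>M |
     (M :: ('a \<times> 'a) measure) (X :: 'a \<times> 'a \<Rightarrow> 'a) (Y :: 'a \<times> 'a \<Rightarrow> 'a).
     prob_space M \<and> X \<in> borel_measurable M \<and> Y \<in> borel_measurable M \<and>
     distr M borel X = \<mu> \<and> distr M borel Y = \<nu>}"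

lemma wasserstein_le:
  fixes M :: "'b measure" and X Y :: "'b \<Rightarrow> 'a::euclidean_space"
  assumes "prob_space M"
    and [measurable]: "X \<in> borel_measurable M" "Y \<in> borel_measurable M"
    and "distr M borel X = \<mu>" "distr M borel Y = \<nu>"
  shows "wasserstein \<mu> \<nu> \<le> (\<integral>\<^sup>+ \<omega>. ennreal ((norm (X \<omega> - Y \<omega>))\<^sup>2) \<partial>M)"
proof -
  let ?P = "distr M (borel \<Otimes>\<^sub>M borel) (\<lambda>\<omega>. (X \<omega>, Y \<omega>))"
  have "prob_space ?P"
    by (rule prob_space.prob_space_distr[OF assms(1)]) measurable
  moreover have "distr ?P borel fst = \<mu>" "distr ?P borel snd = \<nu>"
    using assms by (simp_all add: distr_distr comp_def)
  moreover have "(\<integral>\<^sup>+ \<omega>. ennreal ((norm (X \<omega> - Y \<omega>))\<^sup>2) \<partial>M)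
      = (\<integral>\<^sup>+ z. ennreal ((norm (fst z - snd z))\<^sup>2) \<partial>?P)"
    by (subst nn_integral_distr) auto
  moreover have "fst \<in> borel_measurable ?P" "snd \<in> borel_measurable ?P"
    by simp_all
  ultimately show ?thesis
    unfolding wasserstein_def by (intro Inf_lower CollectI exI[of _ ?P] exI[of _ fst] exI[of _ snd]) simp
qed

text \<open>
  \<open>\<mu>\<^sup>(\<^sup>m\<^sup>)\<close>, with the i.i.d. sequence realised as the coordinates of the infinite product of \<open>\<mu>\<close>.
  By lemma \<open>distr_normalized_sum\<close> below, every i.i.d. sequence with law \<open>\<mu>\<close> gives the same measure.
\<close>

definition normalized_sum_law :: "'a::euclidean_space measure \<Rightarrow> nat \<Rightarrow> 'a measure" where
  "normalized_sum_law \<mu> m =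
     distr (Pi\<^sub>M {1..} (\<lambda>_ :: nat. \<mu>)) borel (\<lambda>x. (1 / sqrt (real m)) *\<^sub>R (\<Sum>i=1..m. x i))"

lemma distr_normalized_sum:
  fixes X :: "nat \<Rightarrow> 'b \<Rightarrow> 'a::euclidean_space"
  assumes "prob_space M"
    and indep: "prob_space.indep_vars M (\<lambda>_. borel) X {1..}"
    and law: "\<And>i. i \<ge> 1 \<Longrightarrow> distr M borel (X i) = \<mu>"
  shows "distr M borel (\<lambda>\<omega>. (1 / sqrt (real m)) *\<^sub>R (\<Sum>i=1..m. X i \<omega>)) = normalized_sum_law \<mu> m"
proof -
  interpret prob_space M by fact
  have rv: "X i \<in> borel_measurable M" if "i \<in> {1..}" for i
    using indep that by (auto simp: indep_vars_def)
  have "distr M (Pi\<^sub>M {1..} (\<lambda>_. borel)) (\<lambda>\<omega>. \<lambda>i\<in>{1..}. X i \<omega>) = Pi\<^sub>M {1..} (\<lambda>i. distr M borel (X i))"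
    using indep rv by (subst (asm) indep_vars_iff_distr_eq_PiM') auto
  also have "\<dots> = Pi\<^sub>M {1..} (\<lambda>_. \<mu>)"
    using law by (intro PiM_cong) auto
  finally have eq: "Pi\<^sub>M {1..} (\<lambda>_. \<mu>) = distr M (Pi\<^sub>M {1..} (\<lambda>_. borel)) (\<lambda>\<omega>. \<lambda>i\<in>{1..}. X i \<omega>)" ..
  have meas: "(\<lambda>x. (1 / sqrt (real m)) *\<^sub>R (\<Sum>i=1..m. x i))
      \<in> (Pi\<^sub>M {1..} (\<lambda>_ :: nat. borel :: 'a measure)) \<rightarrow>\<^sub>M borel"
    by (intro borel_measurable_scaleR borel_measurable_const borel_measurable_sum
        measurable_component_singleton) auto
  have meas': "(\<lambda>\<omega>. \<lambda>i\<in>{1..}. X i \<omega>) \<in> M \<rightarrow>\<^sub>M Pi\<^sub>M {1..} (\<lambda>_. borel)"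
    using rv by (intro measurable_restrict) auto
  show ?thesis
    unfolding normalized_sum_law_def eq distr_distr[OF meas meas']
    by (intro distr_cong) (auto intro!: sum.cong)
qed

end

theory Submission
  imports Defs
begin

text \<open>
  Write \<open>S\<^sub>k\<close> for the simple random walk on the integers after \<open>k\<close> steps. A normalized sum of
  \<open>m\<close> independent copies of \<open>S\<^sub>k\<close> has the law of \<open>S\<^bsub>mk\<^esub> / sqrt m\<close>, so for \<open>\<mu>\<^sub>n\<close> and \<open>\<nu>\<^sub>n\<close> the
  comparison between \<open>m = 2\<close> and \<open>m = 3\<close> is decided by parity.

  For \<open>m = 3\<close> the walks \<open>S\<^bsub>6n-3\<^esub>\<close> and \<open>S\<^bsub>6n\<^esub>\<close> live on the odd and on the even integers. In every
  coupling they differ by at least 1, and the transport cost is at least \<open>1/3\<close>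
  (\<open>wasserstein_walk_law_ge\<close>).

  For \<open>m = 2\<close> both \<open>S\<^bsub>4n-2\<^esub>\<close> and \<open>S\<^bsub>4n\<^esub>\<close> live on the even integers, and the second law is
  the first one averaged with weights \<open>1/4, 1/2, 1/4\<close> over neighbouring even sites. Such a
  smoothing only has to carry, across each edge between neighbouring sites, a quarter of the
  difference of their masses (\<open>smoothing_coupling\<close>). The law of the walk is symmetric and
  unimodal, so these differences telescope, and \<open>E (X - Y)\<^sup>2 = 2 P(S\<^bsub>4n-2\<^esub> = 0)\<close>. After the
  normalization the cost is at most the return probability \<open>P(S\<^bsub>4n-2\<^esub> = 0)\<close>, which decreases along
  even times and equals \<open>5/16\<close> at time 6. Since \<open>5/16 < 1/3\<close>, the inequality fails for all
  \<open>n \<ge> 2\<close>.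

  In a Euclidean space of any dimension the same walk along a unit vector \<open>e\<close> is a counterexample, so
  the walk is carried as a law on the line spanned by a vector \<open>e\<close> throughout; the normalization
  by \<open>sqrt m\<close> then only rescales \<open>e\<close>.
\<close>

section \<open>The simple random walk on the integers\<close>

primrec walk :: "nat \<Rightarrow> int pmf" where
  "walk 0 = return_pmf 0"
| "walk (Suc n) = bind_pmf (walk n) (\<lambda>s. map_pmf (\<lambda>z. s + z) (pmf_of_set {1, -1}))"

lemma pmf_walk_0: "pmf (walk 0) i = of_bool (i = 0)"
  by (simp add: indicator_def)

lemma pmf_walk_Suc: "pmf (walk (Suc n)) i = (pmf (walk n) (i - 1) + pmf (walk n) (i + 1)) / 2"
proof -
  have shift: "pmf (map_pmf (\<lambda>z. s + z) (pmf_of_set {1, -1})) i = of_bool (i - s \<in> {1, -1}) / 2" for s :: int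
  proof -
    have "pmf (map_pmf (\<lambda>z. s + z) (pmf_of_set {1, -1})) (s + (i - s)) = pmf (pmf_of_set {1, -1}) (i - s)"
      by (rule pmf_map_inj') (auto simp: inj_def)
    thus ?thesis by (auto simp: pmf_of_set)
  qed
  have "pmf (walk (Suc n)) i = (\<integral>s. of_bool (i - s \<in> {1, -1}) / 2 \<partial>walk n)"
    by (simp add: pmf_bind shift)
  also have "\<dots> = (\<Sum>s\<in>{i - 1, i + 1}. of_bool (i - s \<in> {1, -1}) / 2 * pmf (walk n) s)"
    by (rule integral_measure_pmf_real) auto
  finally show ?thesis by simp
qed

lemma pmf_walk_add_2:
  "pmf (walk (n + 2)) i = (pmf (walk n) (i - 2) + 2 * pmf (walk n) i + pmf (walk n) (i + 2)) / 4"
proof -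
  have "pmf (walk (n + 2)) i = pmf (walk (Suc (Suc n))) i" by simp
  also have "\<dots> = (pmf (walk n) (i - 2) + 2 * pmf (walk n) i + pmf (walk n) (i + 2)) / 4"
    unfolding pmf_walk_Suc by (simp add: field_simps)
  finally show ?thesis .
qed

lemma pmf_walk_uminus: "pmf (walk n) (- i) = pmf (walk n) i"
proof (induction n arbitrary: i)
  case (Suc n)
  have "- i - 1 = - (i + 1)" "- i + 1 = - (i - 1)" by simp_all
  thus ?case by (simp only: pmf_walk_Suc Suc add.commute)
qed (simp add: pmf_walk_0 del: walk.simps)

lemma set_walk: "set_pmf (walk n) \<subseteq> {i. even (i + int n)} \<inter> {- int n..int n}"
  by (induction n) (fastforce simp: set_pmf_of_set)+

text \<open>
  Starting at \<open>i = - 1\<close>, where symmetry gives equality, makes the induction work: by the recursion,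
  the difference at \<open>i\<close> after \<open>n + 1\<close> steps is half the difference between the sites \<open>i - 1\<close> and
  \<open>i + 3\<close> after \<open>n\<close> steps, which is a sum of two instances of the hypothesis when \<open>i \<ge> 0\<close>.
\<close>

lemma walk_unimodal: "- 1 \<le> i \<Longrightarrow> pmf (walk n) (i + 2) \<le> pmf (walk n) i"
proof (induction n arbitrary: i)
  case (Suc n)
  show ?case
  proof (cases "i = -1")
    case True
    thus ?thesis using pmf_walk_uminus[of "Suc n" 1] by (simp del: walk.simps)
  next
    case False
    hence "pmf (walk n) (i + 3) \<le> pmf (walk n) (i + 1)" "pmf (walk n) (i + 1) \<le> pmf (walk n) (i - 1)"
      using Suc.IH[of "i + 1"] Suc.IH[of "i - 1"] Suc.prems by (simp_all add: algebra_simps)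
    thus ?thesis by (simp add: pmf_walk_Suc add.commute del: walk.simps)
  qed
qed (simp add: pmf_walk_0 del: walk.simps)

lemma walk_return_antimono: "pmf (walk (n + 2)) 0 \<le> pmf (walk n) 0"
  using walk_unimodal[of 0 n] pmf_walk_uminus[of n 2] unfolding pmf_walk_add_2 by simp

lemma walk_return_le:
  assumes "n \<ge> 3"
  shows "pmf (walk (2 * n)) 0 \<le> 5 / 16"
  using assms
proof (induction n rule: dec_induct)
  case base
  show ?case by (simp add: numeral_eq_Suc pmf_walk_Suc pmf_walk_0 del: walk.simps)
next
  case (step n)
  thus ?case using walk_return_antimono[of "2 * n"] by (simp del: walk.simps)
qed

lemma walk_add: "walk (m + n) = map_pmf (\<lambda>(a, b). a + b) (pair_pmf (walk m) (walk n))"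
proof (induction n)
  case 0
  show ?case by (simp add: pair_return_pmf2 pmf.map_comp o_def)
next
  case (Suc n)
  thus ?case
    by (simp add: pair_pmf_def map_bind_pmf bind_map_pmf bind_assoc_pmf bind_return_pmf map_pmf_def add.assoc)
qed

lemma map_uminus_walk: "map_pmf uminus (walk n) = walk n"
proof (rule pmf_eqI)
  fix i
  have "pmf (map_pmf uminus (walk n)) (- (- i)) = pmf (walk n) (- i)"
    by (rule pmf_map_inj') (auto simp: inj_def)
  thus "pmf (map_pmf uminus (walk n)) i = pmf (walk n) i"
    by (simp add: pmf_walk_uminus)
qed

section \<open>Coupling a lattice law with its smoothing\<close>

text \<open>
  The difference of the two laws at \<open>i\<close> is a quarter of the second difference of \<open>A\<close>, so it is
  balanced by a flow of \<open>(A i - A j) / 4\<close> along each edge from \<open>i\<close> to \<open>j = i \<plusminus> d\<close>. Sending the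
  positive part of this flow from \<open>i\<close> to \<open>j\<close> is possible since both edges at \<open>i\<close> together take at
  most half of the mass \<open>A i\<close>. Moved mass travels a distance \<open>\<bar>d\<bar>\<close>.
\<close>

lemma smoothing_coupling:
  fixes A B :: "int pmf" and d :: int
  assumes d: "d \<noteq> 0"
    and B: "\<And>i. pmf B i = (pmf A (i - d) + 2 * pmf A i + pmf A (i + d)) / 4"
    and I: "finite I" "set_pmf A \<subseteq> I"
  obtains P where "map_pmf fst P = A" "map_pmf snd P = B"
    "(\<integral>\<^sup>+z. ennreal ((real_of_int (fst z - snd z))\<^sup>2) \<partial>P) =
       ennreal ((real_of_int d)\<^sup>2 / 4 *
         (\<Sum>i\<in>I. max 0 (pmf A i - pmf A (i + d)) + max 0 (pmf A i - pmf A (i - d))))"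
proof -
  \<comment> \<open>\<open>w i j\<close> is the mass moved from \<open>i\<close> to a neighbour \<open>j\<close>; \<open>K i\<close> is the law of the second
    coordinate given that the first one is \<open>i\<close>.\<close>
  define w where "w i j = max 0 (pmf A i - pmf A j) / 4" for i j
  define xs where "xs i = [(i + d, w i (i + d) / pmf A i), (i - d, w i (i - d) / pmf A i),
     (i, 1 - w i (i + d) / pmf A i - w i (i - d) / pmf A i)]" for i
  define K where "K i = pmf_of_list (xs i)" for i
  define P where "P = bind_pmf A (\<lambda>i. map_pmf (Pair i) (K i))"
  have w_nonneg: "0 \<le> w i j" for i j by (simp add: w_def)
  have w_le: "w i j / pmf A i \<le> 1 / 4" for i j
    by (auto simp: w_def divide_simps less_le max_def)
  have wf: "pmf_of_list_wf (xs i)" for i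
  proof -
    have "0 \<le> 1 - w i (i + d) / pmf A i - w i (i - d) / pmf A i"
      using w_le[of i "i + d"] w_le[of i "i - d"] by linarith
    thus ?thesis by (simp add: pmf_of_list_wf_def xs_def w_nonneg)
  qed
  have K: "pmf (K i) (i + d) = w i (i + d) / pmf A i" "pmf (K i) (i - d) = w i (i - d) / pmf A i"
    "pmf (K i) i = 1 - w i (i + d) / pmf A i - w i (i - d) / pmf A i" for i
    using d unfolding K_def pmf_pmf_of_list[OF wf] by (simp_all add: xs_def)
  have set_K: "set_pmf (K i) \<subseteq> {i + d, i - d, i}" for i
    using set_pmf_of_list[OF wf, of i] by (simp add: K_def xs_def)
  have zero: "w i j = 0" if "pmf A i = 0" for i j
    using that by (simp add: w_def max_def)
  have mass: "pmf (K i) (i + d) * pmf A i = w i (i + d)" "pmf (K i) (i - d) * pmf A i = w i (i - d)"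
    "pmf (K i) i * pmf A i = pmf A i - w i (i + d) - w i (i - d)" for i
    by (cases "pmf A i = 0"; simp add: K zero left_diff_distrib)+
  have "map_pmf fst P = A"
    by (simp add: P_def map_bind_pmf pmf.map_comp o_def map_pmf_const bind_return_pmf')
  moreover have "map_pmf snd P = B"
  proof (rule pmf_eqI)
    fix j
    have "map_pmf snd P = bind_pmf A K"
      by (simp add: P_def map_bind_pmf pmf.map_comp o_def)
    hence "pmf (map_pmf snd P) j = (\<integral>i. pmf (K i) j \<partial>A)" by (simp add: pmf_bind)
    also have "\<dots> = (\<Sum>i\<in>{j - d, j + d, j}. pmf (K i) j * pmf A i)"
    proof (rule integral_measure_pmf_real)
      fix i assume "pmf (K i) j \<noteq> 0"
      hence "j \<in> {i + d, i - d, i}" using set_K[of i] by (auto simp: set_pmf_iff)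
      thus "i \<in> {j - d, j + d, j}" by auto
    qed simp
    also have "\<dots> = pmf (K (j - d)) j * pmf A (j - d) + pmf (K (j + d)) j * pmf A (j + d) + pmf (K j) j * pmf A j"
      using d by simp
    also have "\<dots> = w (j - d) j + w (j + d) j + (pmf A j - w j (j + d) - w j (j - d))"
      using mass(1)[of "j - d"] mass(2)[of "j + d"] mass(3)[of j] by simp
    also have "\<dots> = pmf B j"
      by (simp add: B w_def max_def field_simps)
    finally show "pmf (map_pmf snd P) j = pmf B j" .
  qed
  moreover have "(\<integral>\<^sup>+z. ennreal ((real_of_int (fst z - snd z))\<^sup>2) \<partial>P) =
       ennreal ((real_of_int d)\<^sup>2 / 4 *
         (\<Sum>i\<in>I. max 0 (pmf A i - pmf A (i + d)) + max 0 (pmf A i - pmf A (i - d))))"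
  proof -
    have inner: "(\<integral>\<^sup>+j. ennreal ((real_of_int (i - j))\<^sup>2) \<partial>K i)
      = ennreal ((real_of_int d)\<^sup>2 * (w i (i + d) / pmf A i + w i (i - d) / pmf A i))" for i
    proof -
      have "(\<integral>\<^sup>+j. ennreal ((real_of_int (i - j))\<^sup>2) \<partial>K i)
         = (\<Sum>j\<in>{i + d, i - d, i}. ennreal ((real_of_int (i - j))\<^sup>2) * ennreal (pmf (K i) j))"
        using set_K[of i] by (intro nn_integral_measure_pmf_support) auto
      also have "\<dots> = ennreal (\<Sum>j\<in>{i + d, i - d, i}. (real_of_int (i - j))\<^sup>2 * pmf (K i) j)"
        by (simp add: ennreal_mult' del: of_int_diff of_int_add flip: sum_ennreal)
      also have "(\<Sum>j\<in>{i + d, i - d, i}. (real_of_int (i - j))\<^sup>2 * pmf (K i) j)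
         = (real_of_int d)\<^sup>2 * (w i (i + d) / pmf A i + w i (i - d) / pmf A i)"
        using d by (simp add: K) (simp add: field_simps)
      finally show ?thesis .
    qed
    have "(\<integral>\<^sup>+z. ennreal ((real_of_int (fst z - snd z))\<^sup>2) \<partial>P) =
        (\<integral>\<^sup>+i. ennreal ((real_of_int d)\<^sup>2 * (w i (i + d) / pmf A i + w i (i - d) / pmf A i)) \<partial>A)"
      by (simp add: P_def inner del: of_int_diff)
    also have "\<dots> = (\<Sum>i\<in>I. ennreal ((real_of_int d)\<^sup>2 * (w i (i + d) / pmf A i + w i (i - d) / pmf A i)) * ennreal (pmf A i))"
      using I by (intro nn_integral_measure_pmf_support) auto
    also have "\<dots> = (\<Sum>i\<in>I. ennreal ((real_of_int d)\<^sup>2 * (w i (i + d) + w i (i - d))))"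
      using zero by (intro sum.cong refl) (auto simp: w_nonneg field_simps simp flip: ennreal_mult)
    also have "\<dots> = ennreal (\<Sum>i\<in>I. (real_of_int d)\<^sup>2 * (w i (i + d) + w i (i - d)))"
      by (intro sum_ennreal) (auto simp: w_nonneg)
    also have "(\<Sum>i\<in>I. (real_of_int d)\<^sup>2 * (w i (i + d) + w i (i - d))) = (real_of_int d)\<^sup>2 / 4 *
         (\<Sum>i\<in>I. max 0 (pmf A i - pmf A (i + d)) + max 0 (pmf A i - pmf A (i - d)))"
      by (simp add: w_def sum_distrib_left field_simps)
    finally show ?thesis .
  qed
  ultimately show ?thesis by (rule that)
qed

text \<open>
  The even and the odd sites form two separate chains, each telescoping towards its maximum, at 0
  and at \<open>\<plusminus>1\<close>.
\<close>

lemma sum_unimodal_increments: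
  fixes a :: "int \<Rightarrow> real"
  assumes sym: "\<And>i. a (- i) = a i" and uni: "\<And>i. - 1 \<le> i \<Longrightarrow> a (i + 2) \<le> a i"
  shows "(\<Sum>i\<in>{- int L..int L}. max 0 (a i - a (i + 2)) + max 0 (a i - a (i - 2)))
    = 2 * (a 0 + a 1 - a (int L + 1) - a (int L + 2))"
proof (induction L)
  case 0
  show ?case using uni[of 0] sym[of 2] by simp
next
  case (Suc L)
  define g where "g i = max 0 (a i - a (i + 2)) + max 0 (a i - a (i - 2))" for i
  have "{- int (Suc L)..int (Suc L)} = insert (int L + 1) (insert (- (int L + 1)) {- int L..int L})"
    by auto
  hence "sum g {- int (Suc L)..int (Suc L)} = g (int L + 1) + g (- (int L + 1)) + sum g {- int L..int L}"
    by simp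
  moreover have "g (- i) = g i" for i
    using sym[of i] sym[of "i + 2"] sym[of "i - 2"] by (simp add: g_def)
  moreover have "g (int L + 1) = a (int L + 1) - a (int L + 3)"
    using uni[of "int L + 1"] uni[of "int L - 1"] by (simp add: g_def add.commute)
  moreover have "int (Suc L) + 1 = int L + 2" "int (Suc L) + 2 = int L + 3" by simp_all
  moreover have "sum g {- int L..int L} = 2 * (a 0 + a 1 - a (int L + 1) - a (int L + 2))"
    using Suc by (simp add: g_def)
  ultimately have "sum g {- int (Suc L)..int (Suc L)} = 2 * (a 0 + a 1 - a (int (Suc L) + 1) - a (int (Suc L) + 2))"
    by (simp only: of_nat_Suc) (simp add: algebra_simps)
  thus ?case unfolding g_def .
qed

text \<open>
  For even \<open>n\<close> the odd sites carry no mass, so only the even chain contributes, with sum twice the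
  mass at its peak.
\<close>

lemma walk_coupling:
  assumes "even n"
  obtains P where "map_pmf fst P = walk n" "map_pmf snd P = walk (n + 2)"
    "(\<integral>\<^sup>+z. ennreal ((real_of_int (fst z - snd z))\<^sup>2) \<partial>P) = ennreal (2 * pmf (walk n) 0)"
proof -
  have out: "pmf (walk n) i = 0" if "odd i \<or> i > int n" for i
    using that set_walk[of n] assms by (auto simp: pmf_eq_0_set_pmf)
  obtain P where "map_pmf fst P = walk n" "map_pmf snd P = walk (n + 2)"
    "(\<integral>\<^sup>+z. ennreal ((real_of_int (fst z - snd z))\<^sup>2) \<partial>P) =
       ennreal ((real_of_int 2)\<^sup>2 / 4 * (\<Sum>i\<in>{- int n..int n}.
         max 0 (pmf (walk n) i - pmf (walk n) (i + 2)) + max 0 (pmf (walk n) i - pmf (walk n) (i - 2))))"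
    by (rule smoothing_coupling[of 2 "walk (n + 2)" "walk n" "{- int n..int n}"])
       (use set_walk pmf_walk_add_2 in \<open>auto simp del: walk.simps\<close>)
  moreover have "(\<Sum>i\<in>{- int n..int n}.
         max 0 (pmf (walk n) i - pmf (walk n) (i + 2)) + max 0 (pmf (walk n) i - pmf (walk n) (i - 2))) = 2 * pmf (walk n) 0"
    by (subst sum_unimodal_increments) (auto simp: pmf_walk_uminus walk_unimodal out)
  ultimately show ?thesis using that by (simp del: of_int_diff walk.simps)
qed

section \<open>The walk along a vector and its normalized sums\<close>

definition walk_law :: "'a::euclidean_space \<Rightarrow> nat \<Rightarrow> 'a measure" where
  "walk_law e n = distr (measure_pmf (walk n)) borel (\<lambda>s. real_of_int s *\<^sub>R e)"

lemma sets_walk_law [simp, measurable_cong]: "sets (walk_law e n) = sets borel"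
  by (simp add: walk_law_def)

lemma prob_space_walk_law: "prob_space (walk_law e n)"
  unfolding walk_law_def by (rule prob_space.prob_space_distr) (auto intro: prob_space_measure_pmf)

lemma distr_add_indep_pmf:
  fixes X Y :: "'b \<Rightarrow> 'a::euclidean_space"
  assumes "prob_space M" and ind: "prob_space.indep_var M borel X borel Y"
    and X: "distr M borel X = distr (measure_pmf P) borel f"
    and Y: "distr M borel Y = distr (measure_pmf Q) borel g"
  shows "distr M borel (\<lambda>\<omega>. X \<omega> + Y \<omega>) = distr (measure_pmf (pair_pmf P Q)) borel (\<lambda>(s, t). f s + g t)"
proof (rule measure_eqI)
  interpret prob_space M by fact
  have [measurable]: "X \<in> borel_measurable M" "Y \<in> borel_measurable M"
    using ind by (auto dest: indep_var_rv1 indep_var_rv2)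
  have joint: "distr M (borel \<Otimes>\<^sub>M borel) (\<lambda>\<omega>. (X \<omega>, Y \<omega>)) = distr M borel X \<Otimes>\<^sub>M distr M borel Y"
    using ind by (simp add: indep_var_distribution_eq)
  interpret Y: prob_space "distr M borel Y" by (rule prob_space_distr) simp
  fix A assume "A \<in> sets (distr M borel (\<lambda>\<omega>. X \<omega> + Y \<omega>))"
  hence A [measurable]: "A \<in> sets borel" by simp
  have "emeasure (distr M borel (\<lambda>\<omega>. X \<omega> + Y \<omega>)) A = (\<integral>\<^sup>+x. indicator A x \<partial>distr M borel (\<lambda>\<omega>. X \<omega> + Y \<omega>))"
    by simp
  also have "\<dots> = (\<integral>\<^sup>+\<omega>. indicator A (X \<omega> + Y \<omega>) \<partial>M)"
    by (rule nn_integral_distr) simp_all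
  also have "\<dots> = (\<integral>\<^sup>+z. indicator A (fst z + snd z) \<partial>distr M (borel \<Otimes>\<^sub>M borel) (\<lambda>\<omega>. (X \<omega>, Y \<omega>)))"
    by (subst nn_integral_distr) simp_all
  also have "\<dots> = (\<integral>\<^sup>+x. \<integral>\<^sup>+y. indicator A (x + y) \<partial>distr M borel Y \<partial>distr M borel X)"
    unfolding joint by (subst Y.nn_integral_fst[symmetric]) simp_all
  also have "\<dots> = (\<integral>\<^sup>+s. \<integral>\<^sup>+y. indicator A (f s + y) \<partial>distr M borel Y \<partial>P)"
    unfolding X by (rule nn_integral_distr) (simp, measurable)
  also have "\<dots> = (\<integral>\<^sup>+s. \<integral>\<^sup>+t. indicator A (f s + g t) \<partial>Q \<partial>P)"
    unfolding Y by (simp add: nn_integral_distr)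
  also have "\<dots> = (\<integral>\<^sup>+z. indicator A (case z of (s, t) \<Rightarrow> f s + g t) \<partial>pair_pmf P Q)"
    by (simp add: nn_integral_pair_pmf')
  also have "\<dots> = (\<integral>\<^sup>+x. indicator A x \<partial>distr (measure_pmf (pair_pmf P Q)) borel (\<lambda>(s, t). f s + g t))"
    by (rule nn_integral_distr[symmetric]) simp_all
  also have "\<dots> = emeasure (distr (measure_pmf (pair_pmf P Q)) borel (\<lambda>(s, t). f s + g t)) A"
    by simp
  finally show "emeasure (distr M borel (\<lambda>\<omega>. X \<omega> + Y \<omega>)) A =
    emeasure (distr (measure_pmf (pair_pmf P Q)) borel (\<lambda>(s, t). f s + g t)) A" .
qed simp

lemma distr_sum_walk_law:
  fixes X :: "nat \<Rightarrow> 'b \<Rightarrow> 'a::euclidean_space"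
  assumes "prob_space M" and ind: "prob_space.indep_vars M (\<lambda>_. borel) X {1..}"
    and law: "\<And>i. i \<ge> 1 \<Longrightarrow> distr M borel (X i) = walk_law e k"
  shows "distr M borel (\<lambda>\<omega>. \<Sum>i=1..m. X i \<omega>) = walk_law e (m * k)"
proof (induction m)
  case 0
  interpret prob_space M by fact
  show ?case
    by (rule measure_eqI) (auto simp: walk_law_def emeasure_distr emeasure_space_1 indicator_def split: if_splits)
next
  case (Suc m)
  interpret prob_space M by fact
  have "indep_var
      borel ((\<lambda>x. \<Sum>i=1..m. x i) \<circ> (\<lambda>\<omega>. restrict (\<lambda>i. X i \<omega>) {1..m}))
      borel ((\<lambda>x. x (Suc m)) \<circ> (\<lambda>\<omega>. restrict (\<lambda>i. X i \<omega>) {Suc m}))"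
    by (intro indep_var_compose[OF indep_var_restrict[OF ind]]) auto
  hence "indep_var borel (\<lambda>\<omega>. \<Sum>i=1..m. X i \<omega>) borel (X (Suc m))"
    by (simp add: o_def)
  hence "distr M borel (\<lambda>\<omega>. (\<Sum>i=1..m. X i \<omega>) + X (Suc m) \<omega>) =
     distr (measure_pmf (pair_pmf (walk (m * k)) (walk k))) borel
       (\<lambda>(s, t). real_of_int s *\<^sub>R e + real_of_int t *\<^sub>R e)"
    using Suc.IH law[of "Suc m"] by (intro distr_add_indep_pmf) (auto simp: walk_law_def \<open>prob_space M\<close>)
  also have "\<dots> = walk_law e (m * k + k)"
    by (simp add: walk_law_def walk_add map_pmf_rep_eq distr_distr o_def case_prod_unfold scaleR_add_left)
  finally show ?case by (simp add: add.commute)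
qed

lemma normalized_sum_walk_law:
  fixes e :: "'a::euclidean_space"
  shows "normalized_sum_law (walk_law e k) m = walk_law ((1 / sqrt (real m)) *\<^sub>R e) (m * k)"
proof -
  let ?P = "Pi\<^sub>M {1..} (\<lambda>_ :: nat. walk_law e k)"
  interpret P: prob_space ?P by (intro prob_space_PiM prob_space_walk_law)
  have comp: "distr ?P borel (\<lambda>x. x i) = walk_law e k" if "i \<ge> 1" for i
  proof -
    have "distr ?P borel (\<lambda>x. x i) = distr ?P (walk_law e k) (\<lambda>x. x i)"
      by (intro distr_cong) simp_all
    also have "\<dots> = walk_law e k"
      using that by (intro distr_PiM_component prob_space_walk_law) auto
    finally show ?thesis .
  qed
  have meas [measurable]: "(\<lambda>x. x i) \<in> borel_measurable ?P" if "i \<in> {1..}" for i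
    using measurable_component_singleton[OF that, of "\<lambda>_. walk_law e k"]
      measurable_cong_sets[OF refl sets_walk_law[of e k], of ?P] by blast
  have sum_meas: "(\<lambda>x. \<Sum>i=1..m. x i) \<in> borel_measurable ?P"
    by (intro borel_measurable_sum meas) auto
  have ind: "P.indep_vars (\<lambda>_. borel) (\<lambda>i x. x i) {1..}"
  proof (subst P.indep_vars_iff_distr_eq_PiM')
    have "distr ?P (Pi\<^sub>M {1..} (\<lambda>_. borel)) (\<lambda>x. \<lambda>i\<in>{1..}. x i) = distr ?P ?P (\<lambda>x. x)"
      by (intro distr_cong) (auto simp: space_PiM intro!: sets_PiM_cong)
    thus "distr ?P (Pi\<^sub>M {1..} (\<lambda>_. borel)) (\<lambda>x. \<lambda>i\<in>{1..}. x i) = Pi\<^sub>M {1..} (\<lambda>i. distr ?P borel (\<lambda>x. x i))"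
      using PiM_cong[of "{1..}" "{1..}" "\<lambda>i. distr ?P borel (\<lambda>x. x i)" "\<lambda>_. walk_law e k"] comp by simp
  qed (use meas in auto)
  have "normalized_sum_law (walk_law e k) m =
      distr (distr ?P borel (\<lambda>x. \<Sum>i=1..m. x i)) borel (\<lambda>x. (1 / sqrt (real m)) *\<^sub>R x)"
    unfolding normalized_sum_law_def
    by (subst distr_distr) (use sum_meas in \<open>auto simp: o_def\<close>)
  also have "distr ?P borel (\<lambda>x. \<Sum>i=1..m. x i) = walk_law e (m * k)"
    by (rule distr_sum_walk_law[OF P.prob_space_axioms ind comp])
  also have "distr (walk_law e (m * k)) borel (\<lambda>x. (1 / sqrt (real m)) *\<^sub>R x) = walk_law ((1 / sqrt (real m)) *\<^sub>R e) (m * k)"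
    unfolding walk_law_def by (subst distr_distr) (auto simp: o_def mult.commute)
  finally show ?thesis .
qed

section \<open>Transport cost between two walks\<close>

lemma wasserstein_walk_law_le:
  fixes e :: "'a::euclidean_space"
  assumes "even n"
  shows "wasserstein (walk_law e n) (walk_law e (n + 2)) \<le> ennreal (2 * (norm e)\<^sup>2 * pmf (walk n) 0)"
proof -
  obtain P where P: "map_pmf fst P = walk n" "map_pmf snd P = walk (n + 2)"
    and cost: "(\<integral>\<^sup>+z. ennreal ((real_of_int (fst z - snd z))\<^sup>2) \<partial>P) = ennreal (2 * pmf (walk n) 0)"
    using walk_coupling[OF assms] .
  have law: "walk_law e n = distr P borel (\<lambda>z. real_of_int (fst z) *\<^sub>R e)"
       "walk_law e (n + 2) = distr P borel (\<lambda>z. real_of_int (snd z) *\<^sub>R e)"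
    unfolding walk_law_def P[symmetric] by (simp_all add: map_pmf_rep_eq distr_distr o_def)
  have "wasserstein (walk_law e n) (walk_law e (n + 2)) \<le>
     (\<integral>\<^sup>+z. ennreal ((norm (real_of_int (fst z) *\<^sub>R e - real_of_int (snd z) *\<^sub>R e))\<^sup>2) \<partial>P)"
    by (rule wasserstein_le) (simp_all add: law prob_space_measure_pmf del: add_2_eq_Suc')
  also have "\<dots> = (\<integral>\<^sup>+z. ennreal ((norm e)\<^sup>2) * ennreal ((real_of_int (fst z - snd z))\<^sup>2) \<partial>P)"
    by (intro nn_integral_cong) (simp add: power_mult_distrib mult.commute flip: ennreal_mult scaleR_diff_left)
  also have "\<dots> = ennreal ((norm e)\<^sup>2) * ennreal (2 * pmf (walk n) 0)"
    by (simp add: nn_integral_cmult cost del: of_int_diff)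
  also have "\<dots> = ennreal (2 * (norm e)\<^sup>2 * pmf (walk n) 0)"
    by (simp add: mult_ac flip: ennreal_mult)
  finally show ?thesis .
qed

lemma AE_parity_walk_law:
  fixes X :: "'b \<Rightarrow> 'a::euclidean_space"
  assumes "X \<in> borel_measurable M" "distr M borel X = walk_law e n"
  shows "AE \<omega> in M. \<exists>s. even (s + int n) \<and> X \<omega> = real_of_int s *\<^sub>R e"
proof -
  define S where "S = (\<lambda>s. real_of_int s *\<^sub>R e) ` {s. even (s + int n)}"
  have S [measurable]: "S \<in> sets borel"
    unfolding S_def by (rule sets.countable) auto
  have "\<forall>s\<in>set_pmf (walk n). real_of_int s *\<^sub>R e \<in> S"
    using set_walk[of n] unfolding S_def by blast
  hence "AE x in walk_law e n. x \<in> S"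
    unfolding walk_law_def by (subst AE_distr_iff) (simp_all add: AE_measure_pmf_iff)
  hence "AE x in distr M borel X. x \<in> S"
    by (subst assms(2))
  hence "AE \<omega> in M. X \<omega> \<in> S"
    by (rule AE_distrD[OF assms(1)])
  thus ?thesis by eventually_elim (auto simp: S_def)
qed

text \<open>The supports are in disjoint parity classes of the lattice generated by \<open>e\<close>.\<close>

lemma wasserstein_walk_law_ge:
  fixes e :: "'a::euclidean_space"
  assumes "odd (m + n)"
  shows "ennreal ((norm e)\<^sup>2) \<le> wasserstein (walk_law e m) (walk_law e n)"
  unfolding wasserstein_def
proof (rule Inf_greatest, clarify)
  fix M :: "('a \<times> 'a) measure" and X Y :: "'a \<times> 'a \<Rightarrow> 'a"
  assume "prob_space M" and X: "X \<in> borel_measurable M" "distr M borel X = walk_law e m"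
    and Y: "Y \<in> borel_measurable M" "distr M borel Y = walk_law e n"
  interpret prob_space M by fact
  have "AE \<omega> in M. ennreal ((norm e)\<^sup>2) \<le> ennreal ((norm (X \<omega> - Y \<omega>))\<^sup>2)"
    using AE_parity_walk_law[OF X] AE_parity_walk_law[OF Y]
  proof eventually_elim
    case (elim \<omega>)
    then obtain s t where st: "even (s + int m)" "X \<omega> = real_of_int s *\<^sub>R e"
      "even (t + int n)" "Y \<omega> = real_of_int t *\<^sub>R e" by blast
    with assms have "odd (s - t)" by auto
    hence "1 \<le> \<bar>s - t\<bar>" by (cases "s = t") auto
    hence "1 \<le> \<bar>real_of_int s - real_of_int t\<bar>" by linarith
    hence "1 * norm e \<le> \<bar>real_of_int s - real_of_int t\<bar> * norm e" by (rule mult_right_mono) simp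
    hence "norm e \<le> norm (X \<omega> - Y \<omega>)" by (simp add: st flip: scaleR_diff_left)
    thus ?case by (intro ennreal_leI power_mono) auto
  qed
  hence "(\<integral>\<^sup>+\<omega>. ennreal ((norm e)\<^sup>2) \<partial>M) \<le> (\<integral>\<^sup>+\<omega>. ennreal ((norm (X \<omega> - Y \<omega>))\<^sup>2) \<partial>M)"
    by (rule nn_integral_mono_AE)
  thus "ennreal ((norm e)\<^sup>2) \<le> (\<integral>\<^sup>+\<omega>. ennreal ((norm (X \<omega> - Y \<omega>))\<^sup>2) \<partial>M)"
    by (simp add: emeasure_space_1)
qed

lemma wasserstein_walk_law_increases:
  fixes e :: "'a::euclidean_space"
  assumes e: "norm e = 1" and n: "n \<ge> 2"
  defines "\<mu> \<equiv> walk_law e (2 * n - 1)" and "\<nu> \<equiv> walk_law e (2 * n)"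
  shows "wasserstein (normalized_sum_law \<mu> 2) (normalized_sum_law \<nu> 2)
       < wasserstein (normalized_sum_law \<mu> 3) (normalized_sum_law \<nu> 3)"
proof -
  let ?e = "\<lambda>m :: nat. (1 / sqrt (real m)) *\<^sub>R e"
  have norm: "(norm (?e m))\<^sup>2 = 1 / real m" for m
    by (simp add: e power_divide)
  have "wasserstein (normalized_sum_law \<mu> 2) (normalized_sum_law \<nu> 2)
      = wasserstein (walk_law (?e 2) (2 * (2 * n - 1))) (walk_law (?e 2) (2 * (2 * n - 1) + 2))"
  proof -
    have "2 * (2 * n) = 2 * (2 * n - 1) + 2" using n by simp
    thus ?thesis by (simp only: \<mu>_def \<nu>_def normalized_sum_walk_law)
  qed
  also have "\<dots> \<le> ennreal (2 * (norm (?e 2))\<^sup>2 * pmf (walk (2 * (2 * n - 1))) 0)"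
    by (rule wasserstein_walk_law_le) simp
  also have "\<dots> \<le> ennreal (5 / 16)"
    using walk_return_le[of "2 * n - 1"] n unfolding norm by (intro ennreal_leI) simp
  also have "\<dots> < ennreal (1 / 3)"
    by (simp add: ennreal_less_iff)
  also have "\<dots> = ennreal ((norm (?e 3))\<^sup>2)"
    unfolding norm by simp
  also have "\<dots> \<le> wasserstein (walk_law (?e 3) (3 * (2 * n - 1))) (walk_law (?e 3) (3 * (2 * n)))"
    using n by (intro wasserstein_walk_law_ge) auto
  also have "\<dots> = wasserstein (normalized_sum_law \<mu> 3) (normalized_sum_law \<nu> 3)"
    by (simp add: \<mu>_def \<nu>_def normalized_sum_walk_law)
  finally show ?thesis .
qed

section \<open>Moments and symmetry of the walk\<close>

lemma borel_prob_walk_law: "borel_prob (walk_law e n)"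
  by (simp add: borel_prob_def prob_space_walk_law)

lemma finite_set_walk: "finite (set_pmf (walk n))"
  using set_walk[of n] by (rule finite_subset) simp

lemma finite_second_moment_walk_law: "finite_second_moment (walk_law e n)"
  unfolding finite_second_moment_def walk_law_def
  by (subst integrable_distr_eq) (auto intro: integrable_measure_pmf_finite finite_set_walk)

lemma distr_uminus_walk_law: "distr (walk_law e n) borel uminus = walk_law e n"
proof -
  have "distr (walk_law e n) borel uminus = distr (measure_pmf (map_pmf uminus (walk n))) borel (\<lambda>s. real_of_int s *\<^sub>R e)"
    by (simp add: walk_law_def map_pmf_rep_eq distr_distr o_def)
  thus ?thesis by (simp add: map_uminus_walk walk_law_def)
qed

lemma vanishing_barycenter_walk_law: "vanishing_barycenter (walk_law e n)"
proof -
  have "integrable (walk_law e n) (\<lambda>x. x)"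
    unfolding walk_law_def
    by (subst integrable_distr_eq) (auto intro: integrable_measure_pmf_finite finite_set_walk)
  moreover have "(\<integral>x. x \<partial>walk_law e n) = (\<integral>x. x \<partial>distr (walk_law e n) borel uminus)"
    by (simp add: distr_uminus_walk_law)
  hence "(\<integral>x. x \<partial>walk_law e n) = - (\<integral>x. x \<partial>walk_law e n)"
    by (simp add: integral_distr)
  hence "2 *\<^sub>R (\<integral>x. x \<partial>walk_law e n) = 0"
    by (simp add: scaleR_2 eq_neg_iff_add_eq_0)
  ultimately show ?thesis
    by (simp add: vanishing_barycenter_def)
qed

text \<open>
  The two point masses add up to 1, so \<open>Z\<close> takes no other value outside a null set, and its law is
  that of one step of the walk.
\<close>

lemma distr_fair_sign:
  fixes Z :: "'b \<Rightarrow> real"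
  assumes "prob_space M" and [measurable]: "Z \<in> borel_measurable M"
    and half: "measure M {\<omega> \<in> space M. Z \<omega> = 1} = 1 / 2" "measure M {\<omega> \<in> space M. Z \<omega> = -1} = 1 / 2"
  shows "distr M borel Z = walk_law 1 1"
proof (rule measure_eqI)
  interpret prob_space M by fact
  fix A assume "A \<in> sets (distr M borel Z)"
  hence [measurable]: "A \<in> sets borel" by simp
  have one: "prob {\<omega> \<in> space M. Z \<omega> = 1 \<and> c} = of_bool c / 2" for c by (cases c) (auto simp: half)
  have minus: "prob {\<omega> \<in> space M. Z \<omega> = -1 \<and> c} = of_bool c / 2" for c by (cases c) (auto simp: half)
  have union: "prob {\<omega> \<in> space M. (Z \<omega> = 1 \<and> c) \<or> (Z \<omega> = -1 \<and> d)} = of_bool c / 2 + of_bool d / 2" for c d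
  proof -
    have "{\<omega> \<in> space M. (Z \<omega> = 1 \<and> c) \<or> (Z \<omega> = -1 \<and> d)} =
       {\<omega> \<in> space M. Z \<omega> = 1 \<and> c} \<union> {\<omega> \<in> space M. Z \<omega> = -1 \<and> d}" by auto
    moreover have "prob \<dots> = prob {\<omega> \<in> space M. Z \<omega> = 1 \<and> c} + prob {\<omega> \<in> space M. Z \<omega> = -1 \<and> d}"
      by (rule finite_measure_Union) (measurable, auto)
    ultimately show ?thesis by (simp add: one minus)
  qed
  have "prob {\<omega> \<in> space M. Z \<omega> = 1 \<or> Z \<omega> = -1} = 1"
    using union[of True True] by simp
  hence ae: "AE \<omega> in M. Z \<omega> = 1 \<or> Z \<omega> = -1"
    by (subst (asm) prob_Collect_eq_1) auto
  have "prob (Z -` A \<inter> space M) = prob {\<omega> \<in> space M. (Z \<omega> = 1 \<and> 1 \<in> A) \<or> (Z \<omega> = -1 \<and> -1 \<in> A)}"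
    by (rule finite_measure_eq_AE) (use ae in \<open>auto elim!: eventually_mono\<close>)
  hence L: "emeasure (distr M borel Z) A = ennreal (of_bool (1 \<in> A) / 2 + of_bool (-1 \<in> A) / 2)"
    by (simp add: emeasure_distr emeasure_eq_measure union)
  have "emeasure (walk_law (1::real) 1) A = (\<integral>\<^sup>+s. indicator A (real_of_int s) \<partial>walk 1)"
    unfolding walk_law_def
    by (subst nn_integral_indicator[symmetric], simp, subst nn_integral_distr) simp_all
  also have "\<dots> = (\<Sum>s\<in>{1, -1}. indicator A (real_of_int s) * ennreal (pmf (walk 1) s))"
    by (rule nn_integral_measure_pmf_support) (auto simp: bind_return_pmf set_pmf_of_set)
  also have "\<dots> = ennreal (\<Sum>s\<in>{1, -1}. of_bool (real_of_int s \<in> A) * pmf (walk 1) s)"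
    by (subst sum_ennreal[symmetric]) (auto simp: indicator_def)
  also have "(\<Sum>s\<in>{1, -1}. of_bool (real_of_int s \<in> A) * pmf (walk 1) s) = of_bool (1 \<in> A) / 2 + of_bool (-1 \<in> A) / 2"
    unfolding One_nat_def pmf_walk_Suc pmf_walk_0 by simp
  finally show "emeasure (distr M borel Z) A = emeasure (walk_law 1 1) A"
    by (simp add: L)
qed simp

section \<open>Failure of monotonicity\<close>

text \<open>The two universal statements already fail for \<open>n = 2\<close>, that is for the walks of 3 and 4 steps.\<close>

theorem mainTheorem2:
  shows
    "\<not> (\<forall>(\<mu> :: (real ^ 'd) measure) (\<nu> :: (real ^ 'd) measure) (m :: nat).
        borel_prob \<mu> \<longrightarrow> borel_prob \<nu> \<longrightarrow>
        finite_second_moment \<mu> \<longrightarrow> finite_second_moment \<nu> \<longrightarrow>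
        vanishing_barycenter \<mu> \<longrightarrow> vanishing_barycenter \<nu> \<longrightarrow> m \<ge> 1 \<longrightarrow>
        wasserstein (normalized_sum_law \<mu> (m + 1)) (normalized_sum_law \<nu> (m + 1))
          \<le> wasserstein (normalized_sum_law \<mu> m) (normalized_sum_law \<nu> m))
     \<and> \<not> (\<forall>(\<mu> :: real measure) (\<nu> :: real measure) (m :: nat).
        borel_prob \<mu> \<longrightarrow> borel_prob \<nu> \<longrightarrow>
        finite_second_moment \<mu> \<longrightarrow> finite_second_moment \<nu> \<longrightarrow>
        vanishing_barycenter \<mu> \<longrightarrow> vanishing_barycenter \<nu> \<longrightarrow>
        symmetric_measure \<mu> \<longrightarrow> symmetric_measure \<nu> \<longrightarrow> m \<ge> 1 \<longrightarrow>
        wasserstein (normalized_sum_law \<mu> (m + 1)) (normalized_sum_law \<nu> (m + 1))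
          \<le> wasserstein (normalized_sum_law \<mu> m) (normalized_sum_law \<nu> m))
     \<and> (\<forall>(M :: 'w measure) (Z :: nat \<Rightarrow> 'w \<Rightarrow> real) (\<mu> :: nat \<Rightarrow> real measure) (\<nu> :: nat \<Rightarrow> real measure).
        prob_space M \<longrightarrow>
        prob_space.indep_vars M (\<lambda>_. borel) Z {1..} \<longrightarrow>
        (\<forall>i\<ge>1. distr M borel (Z i) = distr M borel (Z 1)) \<longrightarrow>
        measure M {\<omega> \<in> space M. Z 1 \<omega> = 1} = 1 / 2 \<longrightarrow>
        measure M {\<omega> \<in> space M. Z 1 \<omega> = -1} = 1 / 2 \<longrightarrow>
        (\<forall>n. \<mu> n = distr M borel (\<lambda>\<omega>. \<Sum>i=1..2*n-1. Z i \<omega>)) \<longrightarrow>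
        (\<forall>n. \<nu> n = distr M borel (\<lambda>\<omega>. \<Sum>i=1..2*n. Z i \<omega>)) \<longrightarrow>
        (\<forall>\<^sub>F n in sequentially.
          wasserstein (normalized_sum_law (\<mu> n) 3) (normalized_sum_law (\<nu> n) 3)
            > wasserstein (normalized_sum_law (\<mu> n) 2) (normalized_sum_law (\<nu> n) 2)))"
proof (intro conjI allI impI notI)
  assume *: "\<forall>(\<mu> :: (real ^ 'd) measure) (\<nu> :: (real ^ 'd) measure) (m :: nat).
        borel_prob \<mu> \<longrightarrow> borel_prob \<nu> \<longrightarrow>
        finite_second_moment \<mu> \<longrightarrow> finite_second_moment \<nu> \<longrightarrow>
        vanishing_barycenter \<mu> \<longrightarrow> vanishing_barycenter \<nu> \<longrightarrow> m \<ge> 1 \<longrightarrow>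
        wasserstein (normalized_sum_law \<mu> (m + 1)) (normalized_sum_law \<nu> (m + 1))
          \<le> wasserstein (normalized_sum_law \<mu> m) (normalized_sum_law \<nu> m)"
  obtain e :: "real ^ 'd" where e: "norm e = 1"
    using norm_Basis SOME_Basis by blast
  show False
    using *[rule_format, of "walk_law e (2 * 2 - 1)" "walk_law e (2 * 2)" 2]
      wasserstein_walk_law_increases[OF e, of 2]
    by (simp add: borel_prob_walk_law finite_second_moment_walk_law vanishing_barycenter_walk_law)
next
  assume *: "\<forall>(\<mu> :: real measure) (\<nu> :: real measure) (m :: nat).
        borel_prob \<mu> \<longrightarrow> borel_prob \<nu> \<longrightarrow>
        finite_second_moment \<mu> \<longrightarrow> finite_second_moment \<nu> \<longrightarrow>
        vanishing_barycenter \<mu> \<longrightarrow> vanishing_barycenter \<nu> \<longrightarrow>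
        symmetric_measure \<mu> \<longrightarrow> symmetric_measure \<nu> \<longrightarrow> m \<ge> 1 \<longrightarrow>
        wasserstein (normalized_sum_law \<mu> (m + 1)) (normalized_sum_law \<nu> (m + 1))
          \<le> wasserstein (normalized_sum_law \<mu> m) (normalized_sum_law \<nu> m)"
  show False
    using *[rule_format, of "walk_law 1 (2 * 2 - 1)" "walk_law 1 (2 * 2)" 2]
      wasserstein_walk_law_increases[of "1 :: real" 2]
    by (simp add: borel_prob_walk_law finite_second_moment_walk_law vanishing_barycenter_walk_law
        symmetric_measure_def distr_uminus_walk_law)
next
  fix M :: "'w measure" and Z :: "nat \<Rightarrow> 'w \<Rightarrow> real" and \<mu> \<nu> :: "nat \<Rightarrow> real measure"
  assume "prob_space M" and ind: "prob_space.indep_vars M (\<lambda>_. borel) Z {1..}"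
    and same: "\<forall>i\<ge>1. distr M borel (Z i) = distr M borel (Z 1)"
    and half: "measure M {\<omega> \<in> space M. Z 1 \<omega> = 1} = 1 / 2" "measure M {\<omega> \<in> space M. Z 1 \<omega> = -1} = 1 / 2"
    and \<mu>: "\<forall>n. \<mu> n = distr M borel (\<lambda>\<omega>. \<Sum>i=1..2*n-1. Z i \<omega>)"
    and \<nu>: "\<forall>n. \<nu> n = distr M borel (\<lambda>\<omega>. \<Sum>i=1..2*n. Z i \<omega>)"
  interpret prob_space M by fact
  have "Z 1 \<in> borel_measurable M" using ind by (simp add: indep_vars_def)
  hence "distr M borel (Z i) = walk_law 1 1" if "i \<ge> 1" for i
    using distr_fair_sign[OF prob_space_axioms _ half] same that by metis
  hence sum: "distr M borel (\<lambda>\<omega>. \<Sum>i=1..m. Z i \<omega>) = walk_law 1 m" for m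
    using distr_sum_walk_law[OF prob_space_axioms ind, of 1 1 m] by simp
  show "\<forall>\<^sub>F n in sequentially.
          wasserstein (normalized_sum_law (\<mu> n) 3) (normalized_sum_law (\<nu> n) 3)
            > wasserstein (normalized_sum_law (\<mu> n) 2) (normalized_sum_law (\<nu> n) 2)"
    using eventually_ge_at_top[of 2]
  proof eventually_elim
    case (elim n)
    thus ?case
      unfolding \<mu>[rule_format] \<nu>[rule_format] sum
      by (intro wasserstein_walk_law_increases) simp_all
  qed
qed

end
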